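(* Let $a,b$ be coprime positive integers, $n\ge1$, let $P\in\mathfrak{D}_n^{(a,b)}$ with step sequence $\mathfrak{u}_P$, and let $\delta(P)=(q_1,\ldots,q_b)$ be its horizontal strip-decomposition. Let $\mathbf{v}_1,\ldots,\mathbf{v}_b$ be the sequences defined by (ceilings entrywise) $$\mathbf{v}_1=\left\lceil \tfrac{a}{b}\,\mathfrak{u}_P\right\rceil,\qquad \mathbf{v}_i=\left\lceil \frac{a\,\mathfrak{u}_P-\sum_{j=1}^{i-1}\mathbf{v}_j}{b-i+1}\right\rceil\quad(2\le i\le b).$$ Then for every $1\le i\le b$ the step sequence of $q_i$ is $\mathbf{v}_i$.
   Context: $\mathfrak{D}_n^{(a,b)}$ is the set of lattice paths from $(0,0)$ to $(bn,an)$ with unit steps $N=(0,1)$, $E=(1,0)$ staying weakly above $y=ax/b$. The step sequence $\mathfrak{u}_P=(u_1,\ldots,u_{an})$ records the $x$-coordinate $u_k$ of the $k$-th $N$ step. The height sequence $\mathfrak{h}_P=(h_1,\ldots,h_{bn})$ records the $y$-coordinate $h_k$ of the $k$-th $E$ step. Either sequence determines $P$. The same notions apply to $\mathfrak{D}_{an}^{(1,1)}$. **Horizontal strip-decomposition.** Define $(H_1,\ldots,H_{abn})$ by $H_{(i-1)a+j}=h_i$ for $1\le i\le bn$, $1\le j\le a$. For $1\le i\le b$, $q_i\in\mathfrak{D}_{an}^{(1,1)}$ is the Dyck path with height sequence $(H_i,H_{i+b},\ldots,H_{i+(an-1)b})$. Then $\delta(P)=(q_1,\ldots,q_b)$. 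*)

theory Defs
  imports Complex_Main
begin

datatype step = North | East

type_synonym path = "step list"

text \<open>Coordinates of the end point of a path that starts at the origin.\<close>

definition xpos :: "path \<Rightarrow> nat" where
  "xpos P = count_list P East"

definition ypos :: "path \<Rightarrow> nat" where
  "ypos P = count_list P North"

text \<open>The set \<open>D_n^(a,b)\<close>. The half plane \<open>y \<ge> a x / b\<close> is convex, so a path stays in it
  as soon as all its lattice points do.\<close>

definition dyck_paths :: "nat \<Rightarrow> nat \<Rightarrow> nat \<Rightarrow> path set" where
  "dyck_paths a b n =
     {P. xpos P = b * n \<and> ypos P = a * n \<and>
         (\<forall>k \<le> length P. real (ypos (take k P)) \<ge> real a * real (xpos (take k P)) / real b)}"

text \<open>Lists are indexed from 0: the entry \<open>u_k\<close> of the step sequence is \<open>step_seq P ! (k - 1)\<close>,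
  and similarly for the height sequence.\<close>

definition step_seq :: "path \<Rightarrow> nat list" where
  "step_seq P = map (\<lambda>k. xpos (take k P)) (filter (\<lambda>k. P ! k = North) [0..<length P])"

definition height_seq :: "path \<Rightarrow> nat list" where
  "height_seq P = map (\<lambda>k. ypos (take k P)) (filter (\<lambda>k. P ! k = East) [0..<length P])"

text \<open>The sequence \<open>H\<close> with \<open>H_((i-1)a+j) = h_i\<close> for \<open>1 \<le> j \<le> a\<close>.\<close>

definition stretched_heights :: "nat \<Rightarrow> path \<Rightarrow> nat list" where
  "stretched_heights a P = concat (map (replicate a) (height_seq P))"

text \<open>The path \<open>q_i\<close> of \<open>\<delta>(P) = (q_1, \<dots>, q_b)\<close> is \<open>strip_decomposition a b n P ! (i - 1)\<close>;
  its heights are \<open>H_i, H_(i+b), \<dots>, H_(i+(an-1)b)\<close>.\<close>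

definition strip_decomposition :: "nat \<Rightarrow> nat \<Rightarrow> nat \<Rightarrow> path \<Rightarrow> path list" where
  "strip_decomposition a b n P =
     map (\<lambda>i. THE q. q \<in> dyck_paths 1 1 (a * n) \<and>
            height_seq q = map (\<lambda>k. stretched_heights a P ! (i - 1 + k * b)) [0..<a * n])
       [1..<b + 1]"

end

theory Submission
  imports Defs
begin

text \<open>
  Write \<open>h\<close> and \<open>u\<close> for the height and the step sequence of a path, indexed from 0. They are
  related by a Galois connection: the east step number \<open>i\<close> comes before the north step number
  \<open>k\<close> iff \<open>h i \<le> k\<close>, and also iff \<open>i < u k\<close> (\<open>height_le_iff_less_step\<close>).

  Apply this to the strip \<open>q_i\<close>, then to \<open>P\<close>. Fix \<open>k\<close> and let \<open>A = a * u k\<close> for \<open>P\<close>. The east step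
  number \<open>j\<close> of \<open>q_i\<close> has height \<open>H m\<close> with \<open>m = i - 1 + j b\<close>, which is \<open>h (m div a)\<close>. So it comes
  before the north step number \<open>k\<close> iff \<open>m div a < u k\<close>, iff \<open>i - 1 + j b < A\<close>. Hence the entry
  number \<open>k\<close> of the step sequence of \<open>q_i\<close> is the number of \<open>m < A\<close> in the residue class of \<open>i - 1\<close>
  modulo \<open>b\<close>. These numbers are the \<open>even_share\<close>s of \<open>A\<close>: \<open>A div b\<close> plus an extra unit for the
  first \<open>A mod b\<close> classes (\<open>less_even_share_iff\<close>). The recursion with ceilings deals out the same
  shares, because each recipient in turn takes the average of what is left, rounded up
  (\<open>even_share_greedy\<close>).

  That \<open>q_i\<close> exists uniquely as a Dyck path rests on two facts: every sorted list with entries at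
  most \<open>m\<close> is the height sequence of exactly one path of height \<open>m\<close>
  (\<open>path_of_heights\<close>), and staying above a line through the origin is a bound on each height
  (\<open>above_line_iff\<close>).
\<close>

section \<open>Height and step sequences\<close>

lemma filter_upt_Suc_shift:
  "filter Q [0..<Suc l] = (if Q 0 then [0] else []) @ map Suc (filter (\<lambda>k. Q (Suc k)) [0..<l])"
proof -
  have "[0..<Suc l] = 0 # map Suc [0..<l]"
    by (simp add: upt_conv_Cons map_Suc_upt del: upt_Suc)
  then show ?thesis
    by (simp add: filter_map o_def del: upt_Suc)
qed

lemma pos_simps [simp]:
  "xpos [] = 0" "ypos [] = 0"
  "xpos (East # q) = Suc (xpos q)" "xpos (North # q) = xpos q"
  "ypos (East # q) = ypos q" "ypos (North # q) = Suc (ypos q)"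
  by (simp_all add: xpos_def ypos_def)

lemma height_seq_simps [simp]:
  "height_seq [] = []"
  "height_seq (East # q) = 0 # height_seq q"
  "height_seq (North # q) = map Suc (height_seq q)"
  by (simp_all add: height_seq_def filter_upt_Suc_shift o_def del: upt_Suc)

lemma step_seq_simps [simp]:
  "step_seq [] = []"
  "step_seq (East # q) = map Suc (step_seq q)"
  "step_seq (North # q) = 0 # step_seq q"
  by (simp_all add: step_seq_def filter_upt_Suc_shift o_def del: upt_Suc)

lemma path_induct [case_names Nil East North]:
  assumes "Q []" and "\<And>q. Q q \<Longrightarrow> Q (East # q)" and "\<And>q. Q q \<Longrightarrow> Q (North # q)"
  shows "Q (q :: path)"
proof (induction q)
  case (Cons s q)
  then show ?case using assms by (cases s) auto
qed (use assms in simp)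

lemma length_height_seq [simp]: "length (height_seq q) = xpos q"
  by (induction q rule: path_induct) auto

lemma length_step_seq [simp]: "length (step_seq q) = ypos q"
  by (induction q rule: path_induct) auto

lemma sorted_height_seq: "sorted (height_seq q)"
  by (induction q rule: path_induct) (auto simp: sorted_map)

lemma height_le_ypos: "h \<in> set (height_seq q) \<Longrightarrow> h \<le> ypos q"
  by (induction q arbitrary: h rule: path_induct) auto

lemma step_le_xpos: "u \<in> set (step_seq q) \<Longrightarrow> u \<le> xpos q"
  by (induction q arbitrary: u rule: path_induct) auto

text \<open>Both sides say that the east step number \<open>i\<close> precedes the north step number \<open>k\<close>.\<close>

lemma height_le_iff_less_step:
  assumes "i < xpos q" and "k < ypos q"
  shows "height_seq q ! i \<le> k \<longleftrightarrow> i < step_seq q ! k"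
  using assms
proof (induction q arbitrary: i k rule: path_induct)
  case (East q)
  then show ?case by (cases i) auto
next
  case (North q)
  then show ?case by (cases k) auto
qed auto

section \<open>Paths with prescribed heights\<close>

lemma height_seq_inject:
  assumes "height_seq q = height_seq q'" and "ypos q = ypos q'"
  shows "q = q'"
  using assms
proof (induction q arbitrary: q' rule: path_induct)
  case Nil
  then show ?case
    by (cases q' rule: list.exhaust; cases "hd q'") auto
next
  case (East q)
  then show ?case
    by (cases q' rule: list.exhaust; cases "hd q'") auto
next
  case (North q)
  then show ?case
    by (cases q' rule: list.exhaust; cases "hd q'") (auto dest: map_injective)
qed

text \<open>The path is built from the left: an east step while the first remaining height is 0, and
  otherwise a north step, after which all remaining heights drop by 1.\<close>

lemma path_of_heights:
  assumes "sorted hs" and "\<And>h. h \<in> set hs \<Longrightarrow> h \<le> m"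
  shows "\<exists>!q. height_seq q = hs \<and> ypos q = m"
proof -
  have "\<exists>q. height_seq q = hs \<and> ypos q = m"
    using assms
  proof (induction "m + length hs" arbitrary: m hs rule: less_induct)
    case less
    consider (nil) "hs = []" "m = 0" | (zero) hs' where "hs = 0 # hs'"
      | (pos) m' where "m = Suc m'" "0 \<notin> set hs"
    proof (cases "0 \<in> set hs")
      case True
      then obtain x hs' where "hs = x # hs'" by (cases hs) auto
      with True less.prems(1) have "hs = 0 # hs'" by auto
      then show ?thesis by (rule zero)
    next
      case False
      show ?thesis
      proof (cases m)
        case 0
        with False less.prems(2) have "hs = []" by (cases hs) fastforce+
        with 0 show ?thesis by (rule_tac nil)
      next
        case (Suc m')
        with False show ?thesis by (rule_tac pos)
      qed
    qed
    then show ?case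
    proof cases
      case nil
      then show ?thesis by (intro exI[of _ "[]"]) auto
    next
      case zero
      have "\<exists>q. height_seq q = hs' \<and> ypos q = m"
        by (rule less.hyps) (use less.prems zero in auto)
      then obtain q where "height_seq q = hs'" "ypos q = m" by blast
      with zero show ?thesis by (intro exI[of _ "East # q"]) auto
    next
      case pos
      define hs' where "hs' = map (\<lambda>h. h - 1) hs"
      have hs: "map Suc hs' = hs"
        unfolding hs'_def map_map o_def using pos(2)
        by (intro map_idI) (metis Suc_pred' neq0_conv)
      have "\<exists>q. height_seq q = hs' \<and> ypos q = m'"
      proof (rule less.hyps)
        show "m' + length hs' < m + length hs" using pos by (simp add: hs'_def)
        show "sorted hs'" using less.prems(1) by (simp add: sorted_map flip: hs)
        show "h \<le> m'" if "h \<in> set hs'" for h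
          using less.prems(2)[of "Suc h"] that pos by (auto simp flip: hs)
      qed
      then obtain q where "height_seq q = hs'" "ypos q = m'" by blast
      with pos hs show ?thesis by (intro exI[of _ "North # q"]) auto
    qed
  qed
  then show ?thesis using height_seq_inject by metis
qed

text \<open>A path can only cross the line downwards at the end of an east step. The offsets \<open>c\<close> and
  \<open>d\<close> let the induction absorb the first step of the path.\<close>

lemma above_line_iff:
  fixes a b c d :: nat
  shows "(\<forall>k \<le> length q. c + a * xpos (take k q) \<le> d + b * ypos (take k q)) \<longleftrightarrow>
         c \<le> d \<and> (\<forall>j < xpos q. c + a * Suc j \<le> d + b * height_seq q ! j)"
proof (induction q arbitrary: c d rule: path_induct)
  case (East q)
  show ?case using East[of "c + a" d]
    by (simp add: All_less_Suc2 add_ac flip: less_Suc_eq_le)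
next
  case (North q)
  show ?case using North[of c "d + b"]
    by (simp add: All_less_Suc2 add_ac flip: less_Suc_eq_le) auto
qed auto

lemma dyck_paths_iff_heights:
  assumes "b > 0"
  shows "q \<in> dyck_paths a b n \<longleftrightarrow> xpos q = b * n \<and> ypos q = a * n \<and>
           (\<forall>j < b * n. a * Suc j \<le> b * height_seq q ! j)"
proof -
  have "real y \<ge> real a * real x / real b \<longleftrightarrow> a * x \<le> b * y" for x y
    using assms by (simp add: divide_le_eq mult.commute flip: of_nat_mult)
  then show ?thesis
    using above_line_iff[of q 0 a 0 b] by (auto simp: dyck_paths_def)
qed

section \<open>The strips\<close>

lemma nth_concat_replicate:
  assumes "m < a * length xs"
  shows "concat (map (replicate a) xs) ! m = xs ! (m div a)"
  using assms
proof (induction xs arbitrary: m)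
  case (Cons x xs)
  then have "a > 0" by (cases a) auto
  show ?case
  proof (cases "m < a")
    case False
    then have "m div a = Suc ((m - a) div a)" using \<open>a > 0\<close> by (simp add: le_div_geq)
    with False Cons show ?thesis by (simp add: nth_append)
  qed (simp add: nth_append)
qed simp

lemma strip_index_less:
  fixes N b i j :: nat
  assumes "1 \<le> i" "i \<le> b" "j < N"
  shows "i - 1 + j * b < N * b"
proof -
  have "Suc j * b \<le> N * b" using assms by (intro mult_right_mono) auto
  then show ?thesis using assms by simp
qed

lemma strip_decomposition_nth:
  assumes "a > 0" "b > 0" and P: "P \<in> dyck_paths a b n" and i: "1 \<le> i" "i \<le> b"
  defines "q \<equiv> strip_decomposition a b n P ! (i - 1)"
  shows "xpos q = a * n" and "ypos q = a * n"
    and "j < a * n \<Longrightarrow> height_seq q ! j = height_seq P ! ((i - 1 + j * b) div a)"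
proof -
  have P': "xpos P = b * n" "ypos P = a * n"
    and bound: "\<And>j. j < b * n \<Longrightarrow> a * Suc j \<le> b * height_seq P ! j"
    using P assms(2) by (auto simp: dyck_paths_iff_heights)
  define hs where "hs = map (\<lambda>k. stretched_heights a P ! (i - 1 + k * b)) [0..<a * n]"
  have div_less: "(i - 1 + j * b) div a < b * n" if "j < a * n" for j
    using strip_index_less[OF i that] by (simp add: less_mult_imp_div_less mult_ac)
  have hs_nth: "hs ! j = height_seq P ! ((i - 1 + j * b) div a)" if "j < a * n" for j
  proof -
    have "i - 1 + j * b < a * length (height_seq P)"
      using strip_index_less[OF i that] P' by (simp add: mult_ac)
    then show ?thesis
      using that unfolding hs_def stretched_heights_def by (simp add: nth_concat_replicate)
  qed
  have len: "length hs = a * n" by (simp add: hs_def)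
  have "sorted hs"
    unfolding sorted_iff_nth_mono len
  proof (intro allI impI)
    fix j j' assume "j \<le> j'" "j' < a * n"
    then have "(i - 1 + j * b) div a \<le> (i - 1 + j' * b) div a"
      by (intro div_le_mono) auto
    with \<open>j \<le> j'\<close> \<open>j' < a * n\<close> show "hs ! j \<le> hs ! j'"
      using div_less[of j'] by (simp add: hs_nth P' sorted_nth_mono[OF sorted_height_seq])
  qed
  moreover have "h \<le> a * n" if "h \<in> set hs" for h
  proof -
    from that obtain j where "j < a * n" "h = hs ! j" by (metis in_set_conv_nth len)
    then show ?thesis
      using height_le_ypos[of h P] div_less[of j] by (simp add: hs_nth P')
  qed
  ultimately have ex1: "\<exists>!q. height_seq q = hs \<and> ypos q = a * n"
    by (rule path_of_heights)
  have above: "Suc j \<le> hs ! j" if j: "j < a * n" for j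
  proof -
    let ?m = "i - 1 + j * b"
    \<comment> \<open>The bound to show is \<open>j < h\<close>, so \<open>b j < b h\<close> is enough.\<close>
    have "b * j < Suc ?m" by simp
    also have "Suc ?m \<le> a * Suc (?m div a)"
      using \<open>a > 0\<close> by (simp add: Suc_leI dividend_less_times_div)
    also have "\<dots> \<le> b * hs ! j"
      using bound[OF div_less[OF j]] by (simp only: hs_nth[OF j])
    finally show ?thesis by simp
  qed
  have "q' \<in> dyck_paths 1 1 (a * n) \<and> height_seq q' = hs \<longleftrightarrow> height_seq q' = hs \<and> ypos q' = a * n"
    for q'
    using above len by (auto simp: dyck_paths_iff_heights simp flip: length_height_seq)
  moreover have "q = (THE q. q \<in> dyck_paths 1 1 (a * n) \<and> height_seq q = hs)"
    using i by (simp add: q_def strip_decomposition_def hs_def del: upt_Suc)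
  ultimately have "height_seq q = hs \<and> ypos q = a * n"
    using theI'[OF ex1] by simp
  then show "xpos q = a * n" "ypos q = a * n"
    and "j < a * n \<Longrightarrow> height_seq q ! j = height_seq P ! ((i - 1 + j * b) div a)"
    using hs_nth len by (auto simp flip: length_height_seq)
qed

section \<open>Dealing out evenly\<close>

text \<open>The share of the recipient \<open>i\<close>, counted from 1, when \<open>A\<close> units are dealt out one at a time
  to \<open>b\<close> recipients in cyclic order.\<close>

definition even_share :: "nat \<Rightarrow> nat \<Rightarrow> nat \<Rightarrow> nat" where
  "even_share b A i = A div b + (if i \<le> A mod b then 1 else 0)"

text \<open>The units are numbered from 0, so the recipient \<open>i\<close> gets the units \<open>i - 1 + j * b\<close>.\<close>

lemma less_even_share_iff:
  assumes "1 \<le> i" "i \<le> b"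
  shows "j < even_share b A i \<longleftrightarrow> i - 1 + j * b < A"
proof -
  have A: "A = A div b * b + A mod b" and r: "A mod b < b" using assms by auto
  consider "j < A div b" | "j = A div b" | "j > A div b" by linarith
  then show ?thesis
  proof cases
    case 1
    have "i - 1 + j * b < A" using strip_index_less[OF assms 1] A by linarith
    with 1 show ?thesis by (simp add: even_share_def)
  next
    case 2
    then have "A div b * b = j * b" by simp
    with A have "i - 1 + j * b < A \<longleftrightarrow> i - 1 < A mod b" by linarith
    with 2 assms show ?thesis by (auto simp: even_share_def)
  next
    case 3
    then have "Suc (A div b) * b \<le> j * b" by (intro mult_right_mono) auto
    then have "b + A div b * b \<le> j * b" by simp
    with A r have "\<not> i - 1 + j * b < A" by linarith
    with 3 show ?thesis by (simp add: even_share_def)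
  qed
qed

lemma sum_even_share: "(\<Sum>j = 1..m. even_share b A j) = m * (A div b) + min m (A mod b)"
  by (induction m) (auto simp: even_share_def)

text \<open>After the first \<open>i - 1\<close> recipients, \<open>b - i + 1\<close> quotients and \<open>A mod b - (i - 1)\<close> extra units
  (none, if this is negative) are left. There are fewer extra units than recipients, so rounding
  the average up adds 1 to the quotient iff an extra unit is left.\<close>

lemma even_share_greedy:
  assumes "1 \<le> i" "i \<le> b"
  shows "\<lceil>(real A - (\<Sum>j = 1..i - 1. real (even_share b A j))) / (real b - real i + 1)\<rceil>
         = int (even_share b A i)"
proof -
  define e where "e = A mod b - min (i - 1) (A mod b)"
  define c where "c = b - (i - 1)"
  have "A mod b < b" using assms by simp
  then have "e < c" unfolding c_def e_def using assms by linarith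
  moreover have "real b - real i + 1 = real c" "c + (i - 1) = b"
    using assms by (auto simp: c_def of_nat_diff)
  ultimately have c: "c > 0" "e < c" "real b - real i + 1 = real c" "c + (i - 1) = b"
    by auto
  have share: "even_share b A i = A div b + (if e > 0 then 1 else 0)"
    using assms by (auto simp: even_share_def e_def)
  have "A = A div b * (c + (i - 1)) + A mod b" using c(4) by simp
  also have "\<dots> = c * (A div b) + e + (\<Sum>j = 1..i - 1. even_share b A j)"
    unfolding sum_even_share e_def by (simp add: algebra_simps)
  finally have "real A = real (c * (A div b) + e + (\<Sum>j = 1..i - 1. even_share b A j))"
    by simp
  then have "(real A - (\<Sum>j = 1..i - 1. real (even_share b A j))) / (real b - real i + 1)
             = real (A div b) + real e / real c"
    using c by (simp add: field_simps)
  moreover have "\<lceil>real (A div b) + real e / real c\<rceil> = int (even_share b A i)"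
    unfolding share using c by (intro ceiling_unique) (auto simp: field_simps)
  ultimately show ?thesis by simp
qed

section \<open>Step sequences of the strips\<close>

lemma step_seq_strip:
  assumes "a > 0" "b > 0" and P: "P \<in> dyck_paths a b n" and i: "1 \<le> i" "i \<le> b"
    and k: "k < a * n"
  shows "step_seq (strip_decomposition a b n P ! (i - 1)) ! k = even_share b (a * step_seq P ! k) i"
proof -
  define q where "q = strip_decomposition a b n P ! (i - 1)"
  note q = strip_decomposition_nth[OF assms(1-5), folded q_def]
  have P': "xpos P = b * n" "ypos P = a * n"
    using P by (auto simp: dyck_paths_def)
  let ?A = "a * step_seq P ! k"
  have less_iff: "j < step_seq q ! k \<longleftrightarrow> j < even_share b ?A i" if j: "j < a * n" for j
  proof -
    let ?m = "i - 1 + j * b"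
    have m: "?m div a < xpos P"
      using strip_index_less[OF i j] by (simp add: less_mult_imp_div_less mult_ac P')
    have "j < step_seq q ! k \<longleftrightarrow> height_seq P ! (?m div a) \<le> k"
      using height_le_iff_less_step[of j q k] q j k by simp
    also have "\<dots> \<longleftrightarrow> ?m div a < step_seq P ! k"
      using height_le_iff_less_step[OF m] k by (simp add: P')
    also have "\<dots> \<longleftrightarrow> ?m < ?A"
      using \<open>a > 0\<close> by (simp add: div_less_iff_less_mult mult.commute)
    also have "\<dots> \<longleftrightarrow> j < even_share b ?A i"
      by (simp only: less_even_share_iff[OF i])
    finally show ?thesis .
  qed
  \<comment> \<open>Both sides are at most \<open>a * n\<close>, so the indices \<open>j < a * n\<close> suffice to tell them apart.\<close>
  have "step_seq q ! k \<le> a * n"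
    using step_le_xpos[of "step_seq q ! k" q] q k by simp
  moreover have "even_share b ?A i \<le> a * n"
  proof -
    have "step_seq P ! k \<le> b * n"
      using step_le_xpos[of "step_seq P ! k" P] P' k by simp
    then have "?A \<le> a * (b * n)" by (rule mult_left_mono) simp
    moreover have "(a * n) * b = a * (b * n)" by simp
    ultimately have "\<not> i - 1 + (a * n) * b < ?A" by linarith
    then show ?thesis using less_even_share_iff[OF i] by (metis not_le_imp_less)
  qed
  ultimately show ?thesis
    using less_iff unfolding q_def[symmetric]
    by (metis linorder_neqE_nat order_less_irrefl order_less_le_trans)
qed

theorem theorem6p11:
  fixes a b n :: nat and P :: path and v :: "nat \<Rightarrow> int list"
  assumes "a > 0" and "b > 0" and "coprime a b" and "n \<ge> 1"
    and "P \<in> dyck_paths a b n"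
    and "v 1 = map (\<lambda>u. \<lceil>real a / real b * real u\<rceil>) (step_seq P)"
    and "\<And>i. 2 \<le> i \<Longrightarrow> i \<le> b \<Longrightarrow>
           v i = map (\<lambda>k. \<lceil>(real a * real (step_seq P ! k) - (\<Sum>j = 1..i - 1. real_of_int (v j ! k)))
                            / (real b - real i + 1)\<rceil>)
                   [0..<a * n]"
  shows "\<forall>i \<in> {1..b}. map int (step_seq (strip_decomposition a b n P ! (i - 1))) = v i"
proof
  fix i assume "i \<in> {1..b}"
  then have i: "1 \<le> i" "i \<le> b" by auto
  have yP: "ypos P = a * n" using assms(5) by (simp add: dyck_paths_def)
  have v_eq: "v i = map (\<lambda>k. int (even_share b (a * step_seq P ! k) i)) [0..<a * n]"
    using i
  proof (induction i rule: less_induct)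
    case (less i)
    show ?case
    proof (cases "i = 1")
      case True
      have "\<lceil>real a / real b * real u\<rceil> = int (even_share b (a * u) 1)" for u
        using even_share_greedy[of 1 b "a * u"] assms(2) by simp
      then show ?thesis
        unfolding True assms(6) by (intro nth_equalityI) (simp_all add: yP)
    next
      case False
      with less.prems have "2 \<le> i" by simp
      have "\<lceil>(real a * real (step_seq P ! k) - (\<Sum>j = 1..i - 1. real_of_int (v j ! k)))
              / (real b - real i + 1)\<rceil> = int (even_share b (a * step_seq P ! k) i)"
        if "k < a * n" for k
      proof -
        have "(\<Sum>j = 1..i - 1. real_of_int (v j ! k))
              = (\<Sum>j = 1..i - 1. real (even_share b (a * step_seq P ! k) j))"
          using less that by (intro sum.cong) auto
        then show ?thesis
          using even_share_greedy[OF less.prems, of "a * step_seq P ! k"] by simp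
      qed
      then show ?thesis
        unfolding assms(7)[OF \<open>2 \<le> i\<close> less.prems(2)] by simp
    qed
  qed
  show "map int (step_seq (strip_decomposition a b n P ! (i - 1))) = v i"
    unfolding v_eq
    using strip_decomposition_nth(2)[OF assms(1,2,5) i] step_seq_strip[OF assms(1,2,5) i]
    by (intro nth_equalityI) simp_all
qed

end
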